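(* For $\theta>0$, $\varphi>0$, $\rho\in(-1,1)$ consider the SSVI total implied volatility $$v_{\mathrm{SSVI}}(k)=\sqrt{\frac\theta2\Bigl(1+\rho\varphi k+\sqrt{(\varphi k+\rho)^2+1-\rho^2}\Bigr)},\qquad k\in\mathbb{R},$$ and the condition $$(\ast)\qquad \theta\varphi(1+|\rho|)<4\quad\text{and}\quad\theta\varphi^2(1+|\rho|)\le4.$$ For every $\rho\in(-1,1)$ and $\varphi>0$, condition $(\ast)$ is satisfied for $\theta$ small enough. When $(\ast)$ holds, let $X=X_T$ be a non-negative random variable with $\mathbb{E}[X]=1$ whose total implied volatility is $v_{\mathrm{SSVI}}$, i.e. $\mathbb{E}[(X-e^k)^+]=c_{\mathrm{BS}}(k,v_{\mathrm{SSVI}}(k))$ for all $k\in\mathbb{R}$. Then, for fixed $\rho\in(-1,1)$ and $\varphi>0$, $$\mathbb{E}\bigl[\sqrt{X_T}\,\bigr]=\frac{e^{-\theta/8}}{\sqrt{1+\frac{1+\rho^2}{16}\theta^2\varphi^2}}\,(1+o(1))\qquad\text{as }\theta\to0.$$ Moreover, if $\rho=0$ the formula is exact: $\mathbb{E}\bigl[\sqrt{X_T}\,\bigr]=\dfrac{e^{-\theta/8}}{\sqrt{1+\frac{\theta^2\varphi^2}{16}}}$ for every couple $(\theta,\varphi)$ satisfying $(\ast)$ (with $\rho=0$).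
   Context: Let $N$ be the standard Gaussian cumulative distribution function. The normalized Black-Scholes call price $c_{\mathrm{BS}}:\mathbb{R}\times[0,\infty)\to[0,\infty)$ is $$c_{\mathrm{BS}}(k,v)=N(d_1(k,v))-e^kN(d_0(k,v))\ \text{ if } v>0,\qquad c_{\mathrm{BS}}(k,0)=(1-e^k)^+,$$ where $d_0(k,v)=-\frac kv-\frac v2$ and $d_1(k,v)=-\frac kv+\frac v2$ for $v>0$. It is known (Gatheral–Jacquier) that under condition $(\ast)$ of the claim, $v_{\mathrm{SSVI}}$ is an arbitrage-free total implied volatility, meaning that $K\in(0,\infty)\mapsto c_{\mathrm{BS}}(\log K,v_{\mathrm{SSVI}}(\log K))$ is convex and tends to $0$ as $K\to\infty$; consequently a random variable $X$ as in the claim exists, and its law is uniquely determined by $(\theta,\varphi,\rho)$. *)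

theory Defs
  imports "HOL-Probability.Probability" "HOL-Library.Landau_Symbols"
begin

definition d0 :: "real \<Rightarrow> real \<Rightarrow> real" where
  "d0 k v = - k / v - v / 2"

definition d1 :: "real \<Rightarrow> real \<Rightarrow> real" where
  "d1 k v = - k / v + v / 2"

(* Normalized call price with log-strike k and total volatility v. Only v \<ge> 0 is meaningful;
   for v < 0 the value is the one at v = 0 by convention. *)
definition c_BS :: "real \<Rightarrow> real \<Rightarrow> real" where
  "c_BS k v =
     (if v > 0
      then cdf std_normal_distribution (d1 k v) - exp k * cdf std_normal_distribution (d0 k v)
      else max 0 (1 - exp k))"

definition v_SSVI :: "real \<Rightarrow> real \<Rightarrow> real \<Rightarrow> real \<Rightarrow> real" where
  "v_SSVI \<theta> \<phi> \<rho> k =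
     sqrt (\<theta> / 2 * (1 + \<rho> * \<phi> * k + sqrt ((\<phi> * k + \<rho>)\<^sup>2 + 1 - \<rho>\<^sup>2)))"

definition SSVI_cond :: "real \<Rightarrow> real \<Rightarrow> real \<Rightarrow> bool" where
  "SSVI_cond \<theta> \<phi> \<rho> \<longleftrightarrow>
     \<theta> * \<phi> * (1 + \<bar>\<rho>\<bar>) < 4 \<and> \<theta> * \<phi>\<^sup>2 * (1 + \<bar>\<rho>\<bar>) \<le> 4"

definition has_total_implied_vol :: "'a measure \<Rightarrow> ('a \<Rightarrow> real) \<Rightarrow> (real \<Rightarrow> real) \<Rightarrow> bool" where
  "has_total_implied_vol M X v \<longleftrightarrow>
     (\<forall>k. (\<integral>x. max 0 (X x - exp k) \<partial>M) = c_BS k (v k))"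

definition SSVI_variable ::
    "'a measure \<Rightarrow> ('a \<Rightarrow> real) \<Rightarrow> real \<Rightarrow> real \<Rightarrow> real \<Rightarrow> bool" where
  "SSVI_variable M X \<theta> \<phi> \<rho> \<longleftrightarrow>
     prob_space M \<and> X \<in> borel_measurable M \<and> (AE x in M. 0 \<le> X x) \<and>
     integrable M X \<and> (\<integral>x. X x \<partial>M) = 1 \<and>
     has_total_implied_vol M X (v_SSVI \<theta> \<phi> \<rho>)"

end

theory Submission
  imports Defs "HOL-Real_Asymp.Real_Asymp"
begin

text \<open>
  For small \<open>\<theta>\<close> both sides tend to \<open>1\<close>: one has
  \<open>\<bar>sqrt X - 1\<bar> \<le> \<bar>X - 1\<bar>\<close>, and \<open>E \<bar>X - 1\<bar> = 2 E (X - 1)\<^sup>+\<close> is twice the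
  at-the-money call price, which vanishes with \<open>\<theta>\<close>.

  For \<open>\<rho> = 0\<close>, write \<open>4 sqrt x\<close> as the integral of \<open>min x (exp k) exp (- k / 2)\<close> over all
  \<open>k\<close>, take expectations with \<open>E (min X (exp k)) = 1 - c_BS k (v k)\<close>, and change the variable to
  \<open>u = k / v k\<close>. The point is that \<open>v\<^sup>2 = \<theta> + \<theta>\<^sup>2 \<phi>\<^sup>2 u\<^sup>2 / 4\<close> is affine in \<open>u\<^sup>2\<close>, so that after
  an integration by parts only Gaussian integrals in \<open>u\<close> and in \<open>v\<close> remain.
\<close>

section \<open>The standard normal distribution function\<close>

definition std_normal_cdf :: "real \<Rightarrow> real" ("\<Phi>") where
  "\<Phi> = cdf std_normal_distribution"

interpretation std_normal: real_distribution std_normal_distribution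
  by (rule real_dist_normal_dist)

lemma std_normal_cdf_at_top: "(\<Phi> \<longlongrightarrow> 1) at_top"
  unfolding std_normal_cdf_def by (rule std_normal.cdf_lim_at_top_prob)

lemma std_normal_cdf_at_bot: "(\<Phi> \<longlongrightarrow> 0) at_bot"
  unfolding std_normal_cdf_def by (rule std_normal.cdf_lim_at_bot)

lemma std_normal_cdf_nonneg: "0 \<le> \<Phi> x"
  unfolding std_normal_cdf_def by (rule std_normal.cdf_nonneg)

lemma std_normal_cdf_le_1: "\<Phi> x \<le> 1"
  unfolding std_normal_cdf_def by (rule std_normal.cdf_bounded_prob)

text \<open>To the right of a base point, \<open>\<Phi>\<close> is a constant plus the integral of a
  continuous density, so the fundamental theorem of calculus applies.\<close>

lemma DERIV_std_normal_cdf: "(\<Phi> has_real_derivative std_normal_density x) (at x)"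
proof -
  \<comment> \<open>This base point makes \<open>x\<close> interior to the interval
    \<open>{a..x+1}\<close> used below.\<close>
  define a where "a = x - 1"
  have cont: "continuous_on S std_normal_density" for S
    unfolding std_normal_density_def by (intro continuous_intros) auto
  have eq: "\<Phi> y = \<Phi> a + integral {a..y} std_normal_density" if "a < y" for y
  proof -
    have "\<Phi> y - \<Phi> a = measure std_normal_distribution {a<..y}"
      unfolding std_normal_cdf_def using that by (rule std_normal.cdf_diff_eq)
    also have "\<dots> = (LINT z|std_normal_distribution. indicator {a<..y} z)"
      by simp
    also have "\<dots> = (LINT z|lborel. std_normal_density z *\<^sub>R indicator {a<..y} z)"
      by (rule integral_density) auto
    also have "\<dots> = (LINT z:{a<..y}|lborel. std_normal_density z)"
      by (simp add: set_lebesgue_integral_def mult.commute)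
    also have "\<dots> = (LINT z:{a..y}|lborel. std_normal_density z)"
      using that interval_integral_Icc[of a y std_normal_density]
        interval_integral_Ioc[of a y std_normal_density] by simp
    also have "\<dots> = integral {a..y} std_normal_density"
      by (intro set_borel_integral_eq_integral borel_integrable_atLeastAtMost' cont)
    finally show ?thesis by simp
  qed
  have "((\<lambda>y. \<Phi> a + integral {a..y} std_normal_density) has_real_derivative std_normal_density x)
      (at x within {a..x+1})"
    by (auto intro!: derivative_eq_intros integral_has_real_derivative cont simp: a_def)
  then have "((\<lambda>y. \<Phi> a + integral {a..y} std_normal_density) has_real_derivative
      std_normal_density x) (at x)"
    by (subst (asm) at_within_interior) (auto simp: a_def)
  moreover have "eventually (\<lambda>y. \<Phi> a + integral {a..y} std_normal_density = \<Phi> y) (nhds x)"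
    using eventually_nhds_in_open[of "{a<..}" x] eq by (auto simp: a_def elim!: eventually_mono)
  ultimately show ?thesis
    by (subst (asm) DERIV_cong_ev) auto
qed

lemmas DERIV_std_normal_cdf' [derivative_intros] = DERIV_chain2[OF DERIV_std_normal_cdf]

lemma isCont_std_normal_cdf: "isCont \<Phi> x"
  using DERIV_std_normal_cdf by (rule DERIV_isCont)

lemma DERIV_std_normal_density:
  "(std_normal_density has_real_derivative - x * std_normal_density x) (at x)"
proof -
  have "((\<lambda>x. C * exp (- x\<^sup>2 / 2)) has_real_derivative - x * (C * exp (- x\<^sup>2 / 2))) (at x)" for C
    by (auto intro!: derivative_eq_intros)
  from this[of "1 / sqrt (2 * pi)"] show ?thesis
    unfolding std_normal_density_def .
qed

lemma std_normal_density_minus: "std_normal_density (- x) = std_normal_density x"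
  by (simp add: std_normal_density_def)

text \<open>The density is even, so \<open>\<Phi> (- x) + \<Phi> x\<close> has derivative zero; its
  constant value is read off at infinity.\<close>

lemma std_normal_cdf_minus: "\<Phi> (- x) = 1 - \<Phi> x"
proof -
  have DERIV_0: "((\<lambda>x. \<Phi> (- x) + \<Phi> x) has_real_derivative 0) (at y)" for y
    by (auto intro!: derivative_eq_intros simp: std_normal_density_minus)
  have const: "(\<lambda>y. \<Phi> (- y) + \<Phi> y) = (\<lambda>_. \<Phi> (- x) + \<Phi> x)"
    by (rule ext, rule DERIV_isconst_all[of "\<lambda>x. \<Phi> (- x) + \<Phi> x" _ x]) (use DERIV_0 in simp)
  have "((\<lambda>y. \<Phi> (- y) + \<Phi> y) \<longlongrightarrow> 0 + 1) at_top"
    by (intro tendsto_add std_normal_cdf_at_top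
        filterlim_compose[OF std_normal_cdf_at_bot] filterlim_uminus_at_bot_at_top)
  then have "((\<lambda>y::real. \<Phi> (- x) + \<Phi> x) \<longlongrightarrow> 1) at_top"
    by (subst (asm) const) simp
  then show ?thesis
    by (simp add: tendsto_const_iff)
qed

lemma std_normal_density_at_top: "(std_normal_density \<longlongrightarrow> 0) at_top"
  unfolding std_normal_density_def by real_asymp

text \<open>A Gaussian tail bound: the difference \<open>D\<close> decreases from 1 on and tends to
  zero, hence is nonnegative there. It serves where \<open>\<Phi>\<close> is multiplied by a growing
  exponential.\<close>

lemma std_normal_cdf_minus_le_density:
  assumes "1 \<le> y"
  shows "\<Phi> (- y) \<le> std_normal_density y"
proof -
  define D where "D z = std_normal_density z - \<Phi> (- z)" for z
  have D: "(D has_real_derivative (1 - z) * std_normal_density z) (at z)" for z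
    unfolding D_def
    by (auto intro!: derivative_eq_intros DERIV_std_normal_density
        simp: std_normal_density_minus algebra_simps)
  have mono: "D z \<le> D y" if "y \<le> z" for z
    using that
  proof (rule DERIV_nonpos_imp_nonincreasing)
    fix t assume "y \<le> t" "t \<le> z"
    then show "\<exists>d. (D has_real_derivative d) (at t) \<and> d \<le> 0"
      using D[of t] assms by (intro exI[of _ "(1 - t) * std_normal_density t"]) (auto simp: mult_le_0_iff)
  qed
  have "(D \<longlongrightarrow> 0 - 0) at_top"
    unfolding D_def
    by (intro tendsto_diff std_normal_density_at_top
        filterlim_compose[OF std_normal_cdf_at_bot] filterlim_uminus_at_bot_at_top)
  then have "0 - 0 \<le> D y"
    by (rule tendsto_upperbound) (use mono in \<open>auto intro: eventually_mono[OF eventually_ge_at_top]\<close>)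
  then show ?thesis by (simp add: D_def)
qed

section \<open>A mixture representation of the square root\<close>

text \<open>For nonnegative \<open>f\<close>, finite limits of \<open>F\<close> at both ends already
  give integrability. The nonnegative integral is the form in which Tonelli's theorem is applied
  later.\<close>

lemma nn_integral_FTC_real_line:
  fixes f F :: "real \<Rightarrow> real"
  assumes "\<And>x. (F has_real_derivative f x) (at x)" "\<And>x. isCont f x" "\<And>x. 0 \<le> f x"
    and "(F \<longlongrightarrow> A) at_bot" "(F \<longlongrightarrow> B) at_top"
  shows "(\<integral>\<^sup>+x. ennreal (f x) \<partial>lborel) = ennreal (B - A)"
proof -
  have lim: "((F \<circ> real_of_ereal) \<longlongrightarrow> A) (at_right (-\<infinity>))"
      "((F \<circ> real_of_ereal) \<longlongrightarrow> B) (at_left \<infinity>)"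
    using assms(4,5) by (simp_all add: ereal_tendsto_simps)
  note FTC = interval_integral_FTC_nonneg[of "-\<infinity>" "\<infinity>" F f, OF _ assms(1,2) _ lim]
  have "integrable lborel f" "(LBINT x. f x) = B - A"
    using FTC assms(3)
    by (auto simp: set_integrable_def interval_lebesgue_integral_def set_lebesgue_integral_def)
  then show ?thesis
    using assms(3) by (simp add: nn_integral_eq_integral)
qed

text \<open>The constant 4 makes both branches equal 2 at the origin, where both slopes are 1, so
  they glue differentiably.\<close>

lemma DERIV_exp_abs_primitive:
  fixes t :: real
  shows "((\<lambda>t. if t \<le> 0 then 2 * exp (t / 2) else 4 - 2 * exp (- t / 2)) has_real_derivative
     exp (- \<bar>t\<bar> / 2)) (at t)"
proof -
  have "((\<lambda>t::real. if t \<in> {..0} then 2 * exp (t / 2) else 4 - 2 * exp (- t / 2))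
      has_vector_derivative (if t \<in> {..0} then exp (t / 2) else exp (- t / 2))) (at t within UNIV)"
    by (rule has_vector_derivative_If_within_closures[where T = "{0<..}"])
      (auto simp flip: has_real_derivative_iff_has_vector_derivative
        intro!: derivative_eq_intros)
  moreover have "(if t \<in> {..0} then exp (t / 2) else exp (- t / 2)) = exp (- \<bar>t\<bar> / 2)"
    by auto
  ultimately show ?thesis
    by (simp add: has_real_derivative_iff_has_vector_derivative)
qed

text \<open>With \<open>x = exp L\<close>, both sides are the exponential of
  \<open>min L k - k / 2\<close>. As a function of \<open>k\<close> this is a two-sided exponential
  centred at \<open>ln x\<close>, of total mass \<open>4 * sqrt x\<close>.\<close>

lemma min_exp_eq:
  fixes x k :: real
  assumes "0 < x"
  shows "min x (exp k) * exp (- k / 2) = sqrt x * exp (- \<bar>k - ln x\<bar> / 2)"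
proof -
  define L where "L = ln x"
  have x: "x = exp L"
    using assms by (simp add: L_def)
  have "sqrt x = exp (ln (sqrt x))"
    using assms by simp
  also have "ln (sqrt x) = L / 2"
    using assms by (simp add: L_def ln_sqrt)
  finally have sqrt_x: "sqrt x = exp (L / 2)" .
  show ?thesis
  proof (cases "k \<le> L")
    case True
    then have "L / 2 + - \<bar>k - L\<bar> / 2 = k + - k / 2" by (simp add: field_simps)
    with True show ?thesis
      unfolding sqrt_x unfolding x by (simp add: min_def flip: exp_add)
  next
    case False
    then have "L / 2 + - \<bar>k - L\<bar> / 2 = L + - k / 2" by (simp add: field_simps)
    with False show ?thesis
      unfolding sqrt_x unfolding x by (simp add: min_def flip: exp_add)
  qed
qed

text \<open>The mixture representation of the square root, with the change of variable built in:
  composing the antiderivative \<open>J\<close> of the two-sided exponential with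
  \<open>k u - ln x\<close> produces the factor \<open>k' u\<close> by the chain rule.\<close>

lemma nn_integral_min_exp:
  fixes k k' :: "real \<Rightarrow> real" and x :: real
  assumes k: "\<And>u. (k has_real_derivative k' u) (at u)"
    and k': "\<And>u. isCont k' u" "\<And>u. 0 \<le> k' u"
    and lim: "filterlim k at_bot at_bot" "filterlim k at_top at_top"
    and x: "0 \<le> x"
  shows "(\<integral>\<^sup>+u. ennreal (min x (exp (k u)) * (exp (- k u / 2) * k' u)) \<partial>lborel) = ennreal (4 * sqrt x)"
proof (cases "x = 0")
  case True
  then show ?thesis by (simp add: min_def)
next
  case False
  with x have x: "0 < x" by simp
  define J where "J t = (if t \<le> 0 then 2 * exp (t / 2) else 4 - 2 * exp (- t / 2))" for t :: real
  have J: "(J has_real_derivative exp (- \<bar>t\<bar> / 2)) (at t)" for t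
    using DERIV_exp_abs_primitive[of t] by (simp add: J_def[abs_def])
  note J' = DERIV_chain2[OF J]
  have contk: "isCont k u" for u
    using k by (rule DERIV_isCont)
  have J_bot: "(J \<longlongrightarrow> 0) at_bot"
  proof (rule Lim_transform_eventually)
    show "((\<lambda>t::real. 2 * exp (t / 2)) \<longlongrightarrow> 0) at_bot" by real_asymp
  qed (auto simp: J_def intro: eventually_mono[OF eventually_le_at_bot[of 0]])
  have J_top: "(J \<longlongrightarrow> 4) at_top"
  proof (rule Lim_transform_eventually)
    show "((\<lambda>t::real. 4 - 2 * exp (- t / 2)) \<longlongrightarrow> 4) at_top" by real_asymp
  qed (auto simp: J_def intro: eventually_mono[OF eventually_gt_at_top[of 0]])
  have lim': "filterlim (\<lambda>u. k u - ln x) at_bot at_bot" "filterlim (\<lambda>u. k u - ln x) at_top at_top"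
    by (rule filterlim_compose[OF _ lim(1)] filterlim_compose[OF _ lim(2)], real_asymp)+
  have "(\<integral>\<^sup>+u. ennreal (sqrt x * exp (- \<bar>k u - ln x\<bar> / 2) * k' u) \<partial>lborel) =
      ennreal (sqrt x * 4 - sqrt x * 0)"
  proof (rule nn_integral_FTC_real_line)
    show "((\<lambda>u. sqrt x * J (k u - ln x)) has_real_derivative
        sqrt x * exp (- \<bar>k u - ln x\<bar> / 2) * k' u) (at u)" for u
      by (auto intro!: derivative_eq_intros J' k)
    show "isCont (\<lambda>u. sqrt x * exp (- \<bar>k u - ln x\<bar> / 2) * k' u) u" for u
      by (intro continuous_intros contk k') auto
    show "0 \<le> sqrt x * exp (- \<bar>k u - ln x\<bar> / 2) * k' u" for u
      using k'(2)[of u] x by simp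
    show "((\<lambda>u. sqrt x * J (k u - ln x)) \<longlongrightarrow> sqrt x * 0) at_bot"
      by (intro tendsto_mult tendsto_const filterlim_compose[OF J_bot] lim')
    show "((\<lambda>u. sqrt x * J (k u - ln x)) \<longlongrightarrow> sqrt x * 4) at_top"
      by (intro tendsto_mult tendsto_const filterlim_compose[OF J_top] lim')
  qed
  then show ?thesis
    unfolding mult.assoc[symmetric] min_exp_eq[OF x] by (simp add: mult.commute)
qed

section \<open>The symmetric case\<close>

locale symmetric_SSVI =
  fixes \<theta> \<phi> :: real
  assumes \<theta>: "0 < \<theta>" and \<phi>: "0 < \<phi>"
begin

section \<open>The smile in the variable \<open>u\<close>\<close>

definition c :: real where "c = (\<theta> * \<phi> / 2)\<^sup>2"

text \<open>\<open>w u\<close> and \<open>k u\<close> are the total volatility and the log-strike as functions of \<open>u = k / v\<close>.\<close>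

definition w :: "real \<Rightarrow> real" where "w u = sqrt (\<theta> + c * u\<^sup>2)"

definition k :: "real \<Rightarrow> real" where "k u = u * w u"

definition k' :: "real \<Rightarrow> real" where "k' u = w u + c * u\<^sup>2 / w u"

lemma c_pos: "0 < c"
  using \<theta> \<phi> by (simp add: c_def)

lemma w_pos: "0 < w u"
  using \<theta> c_pos by (simp add: w_def add_pos_nonneg)

lemma w_sq: "(w u)\<^sup>2 = \<theta> + c * u\<^sup>2"
  using \<theta> c_pos by (simp add: w_def)

lemma w_minus: "w (- u) = w u"
  by (simp add: w_def)

lemma k_minus: "k (- u) = - k u"
  by (simp add: k_def w_minus)

lemma k'_minus: "k' (- u) = k' u"
  by (simp add: k'_def w_minus)

text \<open>Under this substitution the inner radicand \<open>(\<phi> * k u)\<^sup>2 + 1\<close> is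
  a perfect square, so only one root survives.\<close>

lemma v_SSVI_k: "v_SSVI \<theta> \<phi> 0 (k u) = w u"
proof -
  have "(\<phi> * k u)\<^sup>2 + 1 = (1 + \<theta> * \<phi>\<^sup>2 * u\<^sup>2 / 2)\<^sup>2"
    unfolding k_def power_mult_distrib w_sq c_def by (simp add: field_simps power2_eq_square)
  moreover have "0 \<le> 1 + \<theta> * \<phi>\<^sup>2 * u\<^sup>2 / 2"
    using \<theta> by simp
  ultimately have "sqrt ((\<phi> * k u)\<^sup>2 + 1) = 1 + \<theta> * \<phi>\<^sup>2 * u\<^sup>2 / 2"
    by simp
  moreover have "v_SSVI \<theta> \<phi> 0 (k u) = sqrt (\<theta> / 2 * (1 + sqrt ((\<phi> * k u)\<^sup>2 + 1)))"
    by (simp add: v_SSVI_def)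
  ultimately have "v_SSVI \<theta> \<phi> 0 (k u) = sqrt (\<theta> / 2 * (1 + (1 + \<theta> * \<phi>\<^sup>2 * u\<^sup>2 / 2)))"
    by (simp only:)
  also have "\<dots> = w u"
    unfolding w_def c_def by (simp add: power2_eq_square field_simps)
  finally show ?thesis .
qed

lemma DERIV_w [derivative_intros]: "(w has_real_derivative c * u / w u) (at u)"
proof -
  have "0 < \<theta> + c * u\<^sup>2" using w_pos[of u] by (simp add: w_def)
  then show ?thesis
    unfolding w_def[abs_def]
    by (auto intro!: derivative_eq_intros simp: field_simps)
qed

lemma DERIV_k: "(k has_real_derivative k' u) (at u)"
  unfolding k_def[abs_def] k'_def
  by (auto intro!: derivative_eq_intros DERIV_w simp: power2_eq_square)

lemma isCont_w: "isCont w u"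
  using DERIV_w by (rule DERIV_isCont)

lemma isCont_k': "isCont k' u"
  unfolding k'_def[abs_def] using w_pos[of u] by (intro continuous_intros isCont_w) auto

lemma k'_nonneg: "0 \<le> k' u"
  unfolding k'_def using w_pos[of u] c_pos by simp

lemma w_at_top: "filterlim w at_top at_top"
  unfolding w_def[abs_def] using \<theta> c_pos by real_asymp

lemma w_at_bot: "filterlim w at_top at_bot"
  unfolding w_def[abs_def] using \<theta> c_pos by real_asymp

lemma k_at_top: "filterlim k at_top at_top"
  unfolding k_def[abs_def] w_def[abs_def] using \<theta> c_pos by real_asymp

lemma k_at_bot: "filterlim k at_bot at_bot"
  unfolding k_def[abs_def] w_def[abs_def] using \<theta> c_pos by real_asymp

text \<open>The term \<open>exp k * \<Phi> (d0 k v)\<close> of one minus the call price, weighted by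
  \<open>exp (- k / 2)\<close>. Its mirror image at \<open>- u\<close> is the other term,
  \<open>\<Phi> (- d1 k v)\<close>, with the same weight.\<close>

definition put_part :: "real \<Rightarrow> real" where
  "put_part u = exp (k u / 2) * \<Phi> (- u - w u / 2)"

text \<open>\<open>s\<close> and \<open>r\<^sup>2\<close> are the coefficients of
  \<open>u\<^sup>2\<close> and \<open>w\<^sup>2\<close> when
  \<open>u\<^sup>2 + w\<^sup>2 / 4\<close> is written, up to a constant, through \<open>u\<close>
  alone or through \<open>w\<close> alone.\<close>

definition s :: real where "s = 1 + c / 4"

definition r :: real where "r = sqrt (1 / c + 1 / 4)"

text \<open>\<open>a\<close>, the value sought for the expectation, and \<open>b\<close> divide by
  the inner derivatives \<open>sqrt s\<close> and \<open>r\<close>; the 2 in \<open>b\<close> comes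
  from \<open>w u / 2\<close> in \<open>put_part\<close>.\<close>

definition a :: real where "a = exp (- \<theta> / 8) / sqrt s"

definition b :: real where "b = exp (\<theta> / (2 * c)) / (2 * r)"

text \<open>
  The last two terms of \<open>G\<close> cancel the density terms of the derivative of \<open>put_part\<close>: up to
  constants, \<open>exp (k / 2)\<close> times the density at \<open>d0\<close> is Gaussian in \<open>u\<close> and also in \<open>w u\<close>.
\<close>

definition G :: "real \<Rightarrow> real" where
  "G u = put_part u + a * \<Phi> (sqrt s * u) + b * \<Phi> (r * w u)"

lemma s_pos: "0 < s" and r_pos: "0 < r"
  using c_pos by (auto simp: s_def r_def add_pos_pos)

text \<open>Since \<open>k u = u * w u\<close>, the exponential cancels exactly the cross term of
  the square in the Gaussian exponent.\<close>

lemma exp_density_s: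
  "exp (k u / 2) * std_normal_density (- u - w u / 2) =
    exp (- \<theta> / 8) * std_normal_density (sqrt s * u)"
proof -
  have "k u / 2 - (- u - w u / 2)\<^sup>2 / 2 = - u\<^sup>2 / 2 - (w u)\<^sup>2 / 8"
    by (simp add: k_def power2_eq_square field_simps)
  also have "\<dots> = - \<theta> / 8 - (sqrt s * u)\<^sup>2 / 2"
    using s_pos by (simp add: w_sq power_mult_distrib s_def field_simps)
  finally have "exp (k u / 2) * exp (- ((- u - w u / 2)\<^sup>2) / 2) =
      exp (- \<theta> / 8) * exp (- ((sqrt s * u)\<^sup>2) / 2)"
    by (simp flip: exp_add)
  then show ?thesis
    unfolding std_normal_density_def by simp
qed

text \<open>The same exponent with \<open>u\<close> eliminated in favour of \<open>w u\<close>; it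
  rests on \<open>s = c * r\<^sup>2\<close>.\<close>

lemma exp_density_r:
  "exp (\<theta> / (2 * c)) * std_normal_density (r * w u) =
    exp (- \<theta> / 8) * std_normal_density (sqrt s * u)"
proof -
  have "\<theta> / (2 * c) - (r * w u)\<^sup>2 / 2 = - \<theta> / 8 - (sqrt s * u)\<^sup>2 / 2"
    using s_pos c_pos by (simp add: w_sq power_mult_distrib s_def r_def field_simps)
  then have "exp (\<theta> / (2 * c)) * exp (- ((r * w u)\<^sup>2) / 2) =
      exp (- \<theta> / 8) * exp (- ((sqrt s * u)\<^sup>2) / 2)"
    by (simp flip: exp_add)
  then show ?thesis
    unfolding std_normal_density_def by simp
qed

lemma DERIV_G: "(G has_real_derivative k' u * put_part u / 2) (at u)"
proof -
  \<comment> \<open>\<open>E\<close> is the common density factor. Differentiating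
    \<open>put_part\<close> leaves \<open>- E\<close> and \<open>- E * (c * u / w u / 2)\<close>;
    facts \<open>2\<close> and \<open>3\<close> supply the opposite terms.\<close>
  define E where "E = exp (- \<theta> / 8) * std_normal_density (sqrt s * u)"
  have "(put_part has_real_derivative k' u / 2 * put_part u +
      exp (k u / 2) * std_normal_density (- u - w u / 2) * (- 1 - c * u / w u / 2)) (at u)"
    unfolding put_part_def[abs_def]
    by (auto intro!: derivative_eq_intros DERIV_k DERIV_w simp: algebra_simps)
  then have 1: "(put_part has_real_derivative k' u / 2 * put_part u - E - E * (c * u / w u / 2)) (at u)"
    by (simp add: exp_density_s E_def algebra_simps)
  have "((\<lambda>u. a * \<Phi> (sqrt s * u)) has_real_derivative a * (std_normal_density (sqrt s * u) * sqrt s)) (at u)"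
    by (auto intro!: derivative_eq_intros)
  moreover have "a * (std_normal_density (sqrt s * u) * sqrt s) = E"
    using s_pos by (simp add: a_def E_def)
  ultimately have 2: "((\<lambda>u. a * \<Phi> (sqrt s * u)) has_real_derivative E) (at u)"
    by simp
  have "((\<lambda>u. b * \<Phi> (r * w u)) has_real_derivative
      b * (std_normal_density (r * w u) * (r * (c * u / w u)))) (at u)"
    by (auto intro!: derivative_eq_intros DERIV_w)
  moreover have "b * (std_normal_density (r * w u) * (r * (c * u / w u))) = 
      exp (\<theta> / (2 * c)) * std_normal_density (r * w u) * (c * u / w u / 2)"
    using r_pos by (simp add: b_def field_simps)
  ultimately have 3: "((\<lambda>u. b * \<Phi> (r * w u)) has_real_derivative E * (c * u / w u / 2)) (at u)"
    by (simp add: exp_density_r E_def)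
  show ?thesis
    unfolding G_def[abs_def] by (rule DERIV_cong[OF DERIV_add[OF DERIV_add[OF 1 2] 3]]) simp
qed

section \<open>Boundary values of the antiderivative \<open>G\<close>\<close>

lemma put_part_nonneg: "0 \<le> put_part u"
  by (simp add: put_part_def std_normal_cdf_nonneg)

lemma isCont_put_part: "isCont put_part u"
  unfolding put_part_def[abs_def]
  by (intro continuous_intros isCont_o2[OF _ isCont_std_normal_cdf] isCont_w DERIV_isCont[OF DERIV_k]) auto

lemma put_part_at_bot: "(put_part \<longlongrightarrow> 0) at_bot"
proof (rule tendsto_sandwich[of "\<lambda>_. 0" _ _ "\<lambda>u. exp (k u / 2)"])
  show "((\<lambda>u. exp (k u / 2)) \<longlongrightarrow> 0) at_bot"
    unfolding k_def[abs_def] w_def[abs_def] using \<theta> c_pos by real_asymp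
  show "\<forall>\<^sub>F u in at_bot. put_part u \<le> exp (k u / 2)"
    by (simp add: put_part_def std_normal_cdf_le_1)
qed (auto simp: put_part_nonneg)

text \<open>Unlike at minus infinity, \<open>exp (k u / 2)\<close> blows up here. The tail bound
  replaces \<open>\<Phi>\<close> by the density, which turns the product into a Gaussian in
  \<open>u\<close>.\<close>

lemma put_part_at_top: "(put_part \<longlongrightarrow> 0) at_top"
proof (rule tendsto_sandwich[of "\<lambda>_. 0" _ _
      "\<lambda>u. exp (- \<theta> / 8) * std_normal_density (sqrt s * u)"])
  show "((\<lambda>u. exp (- \<theta> / 8) * std_normal_density (sqrt s * u)) \<longlongrightarrow> 0) at_top"
    unfolding std_normal_density_def using s_pos by real_asymp
  have "put_part u \<le> exp (- \<theta> / 8) * std_normal_density (sqrt s * u)" if "1 \<le> u" for u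
  proof -
    have "1 \<le> u + w u / 2"
      using that w_pos[of u] by simp
    then have "\<Phi> (- (u + w u / 2)) \<le> std_normal_density (u + w u / 2)"
      by (rule std_normal_cdf_minus_le_density)
    then have "\<Phi> (- u - w u / 2) \<le> std_normal_density (- u - w u / 2)"
      using std_normal_density_minus[of "u + w u / 2"] by simp
    then show ?thesis
      unfolding put_part_def exp_density_s[symmetric] by (intro mult_left_mono) auto
  qed
  then show "\<forall>\<^sub>F u in at_top. put_part u \<le> exp (- \<theta> / 8) * std_normal_density (sqrt s * u)"
    by (rule eventually_mono[OF eventually_ge_at_top[of 1]])
qed (auto simp: put_part_nonneg)

text \<open>As \<open>w\<close> tends to infinity at both ends, the \<open>b\<close> term has the
  same limit at both and later cancels.\<close>

lemma G_at_bot: "(G \<longlongrightarrow> 0 + a * 0 + b * 1) at_bot"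
proof -
  have "filterlim (\<lambda>u. sqrt s * u) at_bot at_bot"
    using s_pos by real_asymp
  moreover have "filterlim (\<lambda>u. r * w u) at_top at_bot"
    by (rule filterlim_tendsto_pos_mult_at_top[OF tendsto_const r_pos w_at_bot])
  ultimately show ?thesis
    unfolding G_def[abs_def]
    by (intro tendsto_intros put_part_at_bot filterlim_compose[OF std_normal_cdf_at_bot]
        filterlim_compose[OF std_normal_cdf_at_top])
qed

lemma G_at_top: "(G \<longlongrightarrow> 0 + a * 1 + b * 1) at_top"
proof -
  have "filterlim (\<lambda>u. sqrt s * u) at_top at_top"
    using s_pos by real_asymp
  moreover have "filterlim (\<lambda>u. r * w u) at_top at_top"
    by (rule filterlim_tendsto_pos_mult_at_top[OF tendsto_const r_pos w_at_top])
  ultimately show ?thesis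
    unfolding G_def[abs_def]
    by (intro tendsto_intros put_part_at_top filterlim_compose[OF std_normal_cdf_at_top])
qed

section \<open>From call prices to the expected square root\<close>

lemma one_minus_call_price:
  "(1 - c_BS (k u) (v_SSVI \<theta> \<phi> 0 (k u))) * (exp (- k u / 2) * k' u) =
    k' u * put_part u + k' (- u) * put_part (- u)"
proof -
  have d: "d1 (k u) (w u) = - (u - w u / 2)" "d0 (k u) (w u) = - u - w u / 2"
    using w_pos[of u] by (simp_all add: d1_def d0_def k_def)
  have "1 - c_BS (k u) (w u) = \<Phi> (u - w u / 2) + exp (k u) * \<Phi> (- u - w u / 2)"
    using w_pos[of u] std_normal_cdf_minus[of "u - w u / 2"]
    by (simp add: c_BS_def d flip: std_normal_cdf_def)
  then have "(1 - c_BS (k u) (w u)) * (exp (- k u / 2) * k' u) =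
      (\<Phi> (u - w u / 2) + exp (k u) * \<Phi> (- u - w u / 2)) * (exp (- k u / 2) * k' u)"
    by (simp only:)
  also have "\<dots> =
      k' u * ((exp (k u) * exp (- k u / 2)) * \<Phi> (- u - w u / 2)) +
      k' u * (exp (- k u / 2) * \<Phi> (u - w u / 2))"
    by (simp add: algebra_simps)
  also have "exp (k u) * exp (- k u / 2) = exp (k u / 2)"
    by (simp flip: exp_add)
  finally show ?thesis
    by (simp add: v_SSVI_k put_part_def k_minus k'_minus w_minus)
qed

text \<open>The integrand is symmetrised in \<open>u\<close>, so \<open>2 * (G u - G (- u))\<close>
  is an antiderivative, with limits \<open>- 2 * a\<close> and \<open>2 * a\<close>.\<close>

lemma nn_integral_call_price:
  "(\<integral>\<^sup>+u. ennreal (k' u * put_part u + k' (- u) * put_part (- u)) \<partial>lborel) = ennreal (4 * a)"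
proof -
  have "(\<integral>\<^sup>+u. ennreal (k' u * put_part u + k' (- u) * put_part (- u)) \<partial>lborel) = ennreal (2 * a - (- 2 * a))"
  proof (rule nn_integral_FTC_real_line)
    have "((\<lambda>u. G (- u)) has_real_derivative k' (- u) * put_part (- u) / 2 * (- 1)) (at u)" for u
      by (rule DERIV_chain2[OF DERIV_G]) (auto intro!: derivative_eq_intros)
    from DERIV_cmult[OF DERIV_diff[OF DERIV_G this], of 2]
    show "((\<lambda>u. 2 * (G u - G (- u))) has_real_derivative
        k' u * put_part u + k' (- u) * put_part (- u)) (at u)" for u
      by (rule DERIV_cong) simp
    show "isCont (\<lambda>u. k' u * put_part u + k' (- u) * put_part (- u)) u" for u
      by (intro continuous_intros isCont_k' isCont_put_part
          isCont_o2[OF _ isCont_k'] isCont_o2[OF _ isCont_put_part])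
    show "0 \<le> k' u * put_part u + k' (- u) * put_part (- u)" for u
      by (simp add: k'_nonneg put_part_nonneg)
    have "((\<lambda>u. 2 * (G u - G (- u))) \<longlongrightarrow> 2 * ((0 + a * 0 + b * 1) - (0 + a * 1 + b * 1))) at_bot"
      by (intro tendsto_intros G_at_bot filterlim_compose[OF G_at_top] filterlim_uminus_at_top_at_bot)
    then show "((\<lambda>u. 2 * (G u - G (- u))) \<longlongrightarrow> - 2 * a) at_bot"
      by simp
    have "((\<lambda>u. 2 * (G u - G (- u))) \<longlongrightarrow> 2 * ((0 + a * 1 + b * 1) - (0 + a * 0 + b * 1))) at_top"
      by (intro tendsto_intros G_at_top filterlim_compose[OF G_at_bot] filterlim_uminus_at_bot_at_top)
    then show "((\<lambda>u. 2 * (G u - G (- u))) \<longlongrightarrow> 2 * a) at_top"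
      by simp
  qed
  then show ?thesis by simp
qed

lemma expectation_sqrt:
  assumes "SSVI_variable M X \<theta> \<phi> 0"
  shows "(\<integral>x. sqrt (X x) \<partial>M) = a"
proof -
  from assms have M: "prob_space M" and X [measurable]: "X \<in> borel_measurable M"
    and X_nonneg: "AE x in M. 0 \<le> X x" and X_int: "integrable M X" and X_1: "(\<integral>x. X x \<partial>M) = 1"
    and call: "\<And>k. (\<integral>x. max 0 (X x - exp k) \<partial>M) = c_BS k (v_SSVI \<theta> \<phi> 0 k)"
    by (auto simp: SSVI_variable_def has_total_implied_vol_def)
  interpret prob_space M by (rule M)
  interpret pair_sigma_finite M lborel ..
  have [measurable]: "k \<in> borel_measurable borel" "k' \<in> borel_measurable borel"
    by (auto intro!: borel_measurable_continuous_onI continuous_at_imp_continuous_on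
        isCont_k' DERIV_isCont[OF DERIV_k])
  have inner: "(\<integral>\<^sup>+x. ennreal (min (X x) (exp (k u)) * (exp (- k u / 2) * k' u)) \<partial>M) =
      ennreal (k' u * put_part u + k' (- u) * put_part (- u))" for u
  proof -
    have int: "integrable M (\<lambda>x. max 0 (X x - exp (k u)))"
      using X_int by (intro integrable_max) auto
    \<comment> \<open>With mean 1, this turns the expectation of the minimum into one minus a call
      price.\<close>
    have eq: "min (X x) (exp (k u)) = X x - max 0 (X x - exp (k u))" for x
      by (auto simp: min_def max_def)
    have "(\<integral>\<^sup>+x. ennreal (min (X x) (exp (k u)) * (exp (- k u / 2) * k' u)) \<partial>M) =
        ennreal (\<integral>x. min (X x) (exp (k u)) * (exp (- k u / 2) * k' u) \<partial>M)"
      using X_nonneg by (intro nn_integral_eq_integral)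
        (auto simp: eq[abs_def] k'_nonneg intro!: X_int int elim!: eventually_mono)
    also have "(\<integral>x. min (X x) (exp (k u)) * (exp (- k u / 2) * k' u) \<partial>M) =
        (1 - c_BS (k u) (v_SSVI \<theta> \<phi> 0 (k u))) * (exp (- k u / 2) * k' u)"
      unfolding eq using X_int int by (simp add: X_1 call)
    finally show ?thesis
      unfolding one_minus_call_price .
  qed
  have "(\<integral>\<^sup>+x. ennreal (4 * sqrt (X x)) \<partial>M) =
      (\<integral>\<^sup>+x. (\<integral>\<^sup>+u. ennreal (min (X x) (exp (k u)) * (exp (- k u / 2) * k' u)) \<partial>lborel) \<partial>M)"
  proof (rule nn_integral_cong_AE)
    show "AE x in M. ennreal (4 * sqrt (X x)) =
        (\<integral>\<^sup>+u. ennreal (min (X x) (exp (k u)) * (exp (- k u / 2) * k' u)) \<partial>lborel)"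
      using X_nonneg
    proof (rule eventually_mono)
      fix x assume "0 \<le> X x"
      from nn_integral_min_exp[OF DERIV_k isCont_k' k'_nonneg k_at_bot k_at_top this]
      show "ennreal (4 * sqrt (X x)) =
          (\<integral>\<^sup>+u. ennreal (min (X x) (exp (k u)) * (exp (- k u / 2) * k' u)) \<partial>lborel)"
        by (rule sym)
    qed
  qed
  also have "\<dots> = (\<integral>\<^sup>+u. (\<integral>\<^sup>+x. ennreal (min (X x) (exp (k u)) * (exp (- k u / 2) * k' u)) \<partial>M) \<partial>lborel)"
    by (rule Fubini'[symmetric]) measurable
  also have "\<dots> = ennreal (4 * a)"
    by (simp only: inner nn_integral_call_price)
  \<comment> \<open>The finite nonnegative integral also yields integrability of the square
    root.\<close>
  finally have "has_bochner_integral M (\<lambda>x. 4 * sqrt (X x)) (4 * a)"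
    using X_nonneg s_pos
    by (intro has_bochner_integral_nn_integral) (auto elim!: eventually_mono simp: a_def)
  then have "(\<integral>x. 4 * sqrt (X x) \<partial>M) = 4 * a"
    by (rule has_bochner_integral_integral_eq)
  then show ?thesis by simp
qed

end

section \<open>Small maturities\<close>

lemma eventually_SSVI_cond: "\<forall>\<^sub>F \<theta> in at_right 0. SSVI_cond \<theta> \<phi> \<rho>"
proof -
  have "((\<lambda>\<theta>. \<theta> * \<phi> * (1 + \<bar>\<rho>\<bar>)) \<longlongrightarrow> 0 * \<phi> * (1 + \<bar>\<rho>\<bar>)) (at_right 0)"
    "((\<lambda>\<theta>. \<theta> * \<phi>\<^sup>2 * (1 + \<bar>\<rho>\<bar>)) \<longlongrightarrow> 0 * \<phi>\<^sup>2 * (1 + \<bar>\<rho>\<bar>)) (at_right 0)"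
    by (intro tendsto_intros)+
  then have "\<forall>\<^sub>F \<theta> in at_right 0. \<theta> * \<phi> * (1 + \<bar>\<rho>\<bar>) < 4"
      "\<forall>\<^sub>F \<theta> in at_right 0. \<theta> * \<phi>\<^sup>2 * (1 + \<bar>\<rho>\<bar>) < 4"
    by (auto dest!: order_tendstoD(2)[where a = 4])
  then show ?thesis
    by eventually_elim (simp add: SSVI_cond_def)
qed

text \<open>At the money the inner root is 1 for every \<open>\<rho>\<close>, so the call price
  there depends on \<open>\<theta>\<close> alone.\<close>

lemma v_SSVI_0: "v_SSVI \<theta> \<phi> \<rho> 0 = sqrt \<theta>"
  by (simp add: v_SSVI_def)

lemma abs_sqrt_minus_1_le:
  fixes x :: real
  assumes "0 \<le> x"
  shows "\<bar>sqrt x - 1\<bar> \<le> \<bar>x - 1\<bar>"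
proof -
  have "x - 1 = (sqrt x - 1) * (sqrt x + 1)"
    using assms by (simp add: algebra_simps)
  then have "\<bar>x - 1\<bar> = \<bar>sqrt x - 1\<bar> * (sqrt x + 1)"
    using assms by (simp add: abs_mult)
  also have "\<dots> \<ge> \<bar>sqrt x - 1\<bar> * 1"
    using assms by (intro mult_left_mono) auto
  finally show ?thesis by simp
qed

lemma expectation_sqrt_near_1:
  assumes "SSVI_variable M X \<theta> \<phi> \<rho>" and "0 < \<theta>"
  shows "\<bar>(\<integral>x. sqrt (X x) \<partial>M) - 1\<bar> \<le> 2 * (\<Phi> (sqrt \<theta> / 2) - \<Phi> (- sqrt \<theta> / 2))"
proof -
  from assms have M: "prob_space M" and X [measurable]: "X \<in> borel_measurable M"
    and X_nonneg: "AE x in M. 0 \<le> X x" and X_int: "integrable M X" and X_1: "(\<integral>x. X x \<partial>M) = 1"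
    and call: "(\<integral>x. max 0 (X x - exp 0) \<partial>M) = c_BS 0 (v_SSVI \<theta> \<phi> \<rho> 0)"
    unfolding SSVI_variable_def has_total_implied_vol_def by blast+
  interpret prob_space M by (rule M)
  have int: "integrable M (\<lambda>x. max 0 (X x - 1))"
    using X_int by (intro integrable_max) auto
  \<comment> \<open>The linear part \<open>X x - 1\<close> has expectation zero, which leaves twice
    the call price at strike 1.\<close>
  have eq: "\<bar>X x - 1\<bar> = 2 * max 0 (X x - 1) - (X x - 1)" for x
    by (auto simp: max_def)
  have int': "integrable M (\<lambda>x. sqrt (X x) - 1)"
    by (rule Bochner_Integration.integrable_bound[of M "\<lambda>x. X x - 1"])
      (use X_int X_nonneg in \<open>auto elim!: eventually_mono intro!: abs_sqrt_minus_1_le\<close>)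
  have sqrt_int: "integrable M (\<lambda>x. sqrt (X x))"
    using Bochner_Integration.integrable_add[OF int' integrable_const[of 1]] by simp
  have "\<bar>(\<integral>x. sqrt (X x) \<partial>M) - 1\<bar> = \<bar>\<integral>x. sqrt (X x) - 1 \<partial>M\<bar>"
    using sqrt_int by (simp add: prob_space)
  also have "\<dots> \<le> (\<integral>x. \<bar>sqrt (X x) - 1\<bar> \<partial>M)"
    by (rule integral_abs_bound)
  also have "\<dots> \<le> (\<integral>x. \<bar>X x - 1\<bar> \<partial>M)"
    using X_nonneg X_int int'
    by (intro integral_mono_AE) (auto elim!: eventually_mono intro!: abs_sqrt_minus_1_le)
  also have "\<dots> = 2 * (\<integral>x. max 0 (X x - exp 0) \<partial>M)"
    unfolding eq using X_int int by (simp add: X_1 prob_space)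
  also have "\<dots> = 2 * (\<Phi> (sqrt \<theta> / 2) - \<Phi> (- sqrt \<theta> / 2))"
    unfolding call v_SSVI_0 using assms(2) by (simp add: c_BS_def d1_def d0_def std_normal_cdf_def)
  finally show ?thesis .
qed

theorem proposition5p3:
  shows "(\<forall>\<rho>\<in>{-1<..<1}. \<forall>\<phi>>0. \<forall>\<^sub>F \<theta> in at_right 0. SSVI_cond \<theta> \<phi> \<rho>) \<and>
    (\<forall>\<rho>\<in>{-1<..<1}. \<forall>\<phi>>0. \<forall>(M :: real \<Rightarrow> 'a measure) (X :: real \<Rightarrow> 'a \<Rightarrow> real).
       (\<forall>\<theta>>0. SSVI_cond \<theta> \<phi> \<rho> \<longrightarrow> SSVI_variable (M \<theta>) (X \<theta>) \<theta> \<phi> \<rho>) \<longrightarrow>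
       (\<lambda>\<theta>. \<integral>x. sqrt (X \<theta> x) \<partial>(M \<theta>)) \<sim>[at_right 0]
       (\<lambda>\<theta>. exp (- \<theta> / 8) / sqrt (1 + (1 + \<rho>\<^sup>2) / 16 * \<theta>\<^sup>2 * \<phi>\<^sup>2))) \<and>
    (\<forall>\<theta>>0. \<forall>\<phi>>0. \<forall>(M :: 'a measure) (X :: 'a \<Rightarrow> real).
       SSVI_cond \<theta> \<phi> 0 \<longrightarrow> SSVI_variable M X \<theta> \<phi> 0 \<longrightarrow>
       (\<integral>x. sqrt (X x) \<partial>M) = exp (- \<theta> / 8) / sqrt (1 + \<theta>\<^sup>2 * \<phi>\<^sup>2 / 16))"
proof (intro conjI ballI allI impI)
  show "\<forall>\<^sub>F \<theta> in at_right 0. SSVI_cond \<theta> \<phi> \<rho>" for \<phi> \<rho>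
    by (rule eventually_SSVI_cond)
next
  fix \<rho> \<phi> :: real and M :: "real \<Rightarrow> 'a measure" and X :: "real \<Rightarrow> 'a \<Rightarrow> real"
  assume *: "\<forall>\<theta>>0. SSVI_cond \<theta> \<phi> \<rho> \<longrightarrow> SSVI_variable (M \<theta>) (X \<theta>) \<theta> \<phi> \<rho>"
  from eventually_SSVI_cond[of \<phi> \<rho>] eventually_at_right_less[of "0 :: real"]
  have "\<forall>\<^sub>F \<theta> in at_right 0. norm ((\<integral>x. sqrt (X \<theta> x) \<partial>(M \<theta>)) - 1) \<le>
      2 * (\<Phi> (sqrt \<theta> / 2) - \<Phi> (- sqrt \<theta> / 2))"
  proof eventually_elim
    case (elim \<theta>)
    with * have "SSVI_variable (M \<theta>) (X \<theta>) \<theta> \<phi> \<rho>" by simp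
    from expectation_sqrt_near_1[OF this elim(2)] show ?case by simp
  qed
  \<comment> \<open>By continuity of \<open>\<Phi>\<close> at 0 the bound tends to zero.\<close>
  moreover have "((\<lambda>\<theta>. 2 * (\<Phi> (sqrt \<theta> / 2) - \<Phi> (- sqrt \<theta> / 2))) \<longlongrightarrow>
      2 * (\<Phi> (sqrt 0 / 2) - \<Phi> (- sqrt 0 / 2))) (at_right 0)"
    by (intro tendsto_intros isCont_tendsto_compose[OF isCont_std_normal_cdf]) auto
  ultimately have "((\<lambda>\<theta>. (\<integral>x. sqrt (X \<theta> x) \<partial>(M \<theta>)) - 1) \<longlongrightarrow> 0) (at_right 0)"
    by (elim Lim_null_comparison) simp
  then have "((\<lambda>\<theta>. \<integral>x. sqrt (X \<theta> x) \<partial>(M \<theta>)) \<longlongrightarrow> 1) (at_right 0)"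
    by (simp add: LIM_zero_iff)
  then have lhs: "(\<lambda>\<theta>. \<integral>x. sqrt (X \<theta> x) \<partial>(M \<theta>)) \<sim>[at_right 0] (\<lambda>_. 1)"
    by (intro tendsto_imp_asymp_equiv_const) auto
  \<comment> \<open>The closed form tends to 1 as well, so both sides are equivalent through the
    constant 1.\<close>
  have "((\<lambda>\<theta>. exp (- \<theta> / 8) / sqrt (1 + (1 + \<rho>\<^sup>2) / 16 * \<theta>\<^sup>2 * \<phi>\<^sup>2)) \<longlongrightarrow>
      exp (- 0 / 8) / sqrt (1 + (1 + \<rho>\<^sup>2) / 16 * 0\<^sup>2 * \<phi>\<^sup>2)) (at_right 0)"
    by (intro tendsto_intros) auto
  then have rhs: "(\<lambda>\<theta>. exp (- \<theta> / 8) / sqrt (1 + (1 + \<rho>\<^sup>2) / 16 * \<theta>\<^sup>2 * \<phi>\<^sup>2)) \<sim>[at_right 0] (\<lambda>_. 1)"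
    by (intro tendsto_imp_asymp_equiv_const) auto
  show "(\<lambda>\<theta>. \<integral>x. sqrt (X \<theta> x) \<partial>(M \<theta>)) \<sim>[at_right 0]
       (\<lambda>\<theta>. exp (- \<theta> / 8) / sqrt (1 + (1 + \<rho>\<^sup>2) / 16 * \<theta>\<^sup>2 * \<phi>\<^sup>2))"
    using lhs asymp_equiv_symI[OF rhs] by (rule asymp_equiv_trans)
next
  fix \<theta> \<phi> :: real and M :: "'a measure" and X :: "'a \<Rightarrow> real"
  assume "0 < \<theta>" "0 < \<phi>" and X: "SSVI_variable M X \<theta> \<phi> 0"
  then interpret symmetric_SSVI \<theta> \<phi>
    by unfold_locales
  have "s = 1 + \<theta>\<^sup>2 * \<phi>\<^sup>2 / 16"
    by (simp add: s_def c_def power_divide power_mult_distrib)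
  then show "(\<integral>x. sqrt (X x) \<partial>M) = exp (- \<theta> / 8) / sqrt (1 + \<theta>\<^sup>2 * \<phi>\<^sup>2 / 16)"
    using expectation_sqrt[OF X] by (simp add: a_def)
qed

end
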